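(* Let $G=(V,E)$ be a finite simple oriented graph with $E\neq\emptyset$, and for $e\in E$ let $\alpha(e)$ be the number of 3-cliques of $G$ in which $e$ participates. If $\frac{1}{|E|}\sum_{e\in E}\alpha(e)<3$, then $G$ is not an FBD-graph. Similarly, if $\max_{e\in E}\alpha(e)=2$, then $G$ is not an FBD-graph.
   Context: A finite simple oriented graph is a pair $G=(V,E)$ with $V$ a finite set and $E\subseteq\{(i,j)\in V\times V : i\neq j\}$ such that $(i,j)\in E$ implies $(j,i)\notin E$. Vertices $a,b,c\in V$ form a (directed) 3-cycle iff $(a,b),(b,c),(c,a)\in E$, and a simplex iff $(a,b),(b,c),(a,c)\in E$. A 3-clique is a set of three vertices which (in some order) form a 3-cycle or a simplex, i.e. three pairwise adjacent vertices; an edge participates in a 3-clique if both its endpoints belong to it. An edge $(a,b)\in E$ is blocked iff there is a vertex $c\in V$ with $(a,c),(c,b)\in E$. A graph is fully blocked iff all of its edges are blocked. An FBD-graph is a fully blocked, finite, non-empty (i.e. having at least one edge) simple oriented graph without directed 3-cycles. *)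

theory Defs
  imports Complex_Main "Graph_Theory.Pair_Digraph"
begin

text \<open>
  A \<open>pair_digraph\<close> has finite vertex and arc sets, arcs between vertices, and no loops;
  the null graph is allowed.
\<close>

locale oriented_graph = pair_digraph +
  assumes asym_arcs: "asym (parcs G)"

definition three_cycle :: "'a pair_pre_digraph \<Rightarrow> 'a \<Rightarrow> 'a \<Rightarrow> 'a \<Rightarrow> bool" where
  "three_cycle G a b c \<longleftrightarrow>
     a \<in> pverts G \<and> b \<in> pverts G \<and> c \<in> pverts G \<and>
     (a, b) \<in> parcs G \<and> (b, c) \<in> parcs G \<and> (c, a) \<in> parcs G"

definition simplex :: "'a pair_pre_digraph \<Rightarrow> 'a \<Rightarrow> 'a \<Rightarrow> 'a \<Rightarrow> bool" where
  "simplex G a b c \<longleftrightarrow>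
     a \<in> pverts G \<and> b \<in> pverts G \<and> c \<in> pverts G \<and>
     (a, b) \<in> parcs G \<and> (b, c) \<in> parcs G \<and> (a, c) \<in> parcs G"

definition three_cliques :: "'a pair_pre_digraph \<Rightarrow> 'a set set" where
  "three_cliques G =
     {K. card K = 3 \<and> (\<exists>a b c. K = {a, b, c} \<and> (three_cycle G a b c \<or> simplex G a b c))}"

definition participates :: "'a \<times> 'a \<Rightarrow> 'a set \<Rightarrow> bool" where
  "participates e K \<longleftrightarrow> fst e \<in> K \<and> snd e \<in> K"

definition clique_count :: "'a pair_pre_digraph \<Rightarrow> 'a \<times> 'a \<Rightarrow> nat" where
  "clique_count G e = card {K \<in> three_cliques G. participates e K}"

definition blocked :: "'a pair_pre_digraph \<Rightarrow> 'a \<times> 'a \<Rightarrow> bool" where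
  "blocked G e \<longleftrightarrow> (\<exists>c \<in> pverts G. (fst e, c) \<in> parcs G \<and> (c, snd e) \<in> parcs G)"

definition fully_blocked :: "'a pair_pre_digraph \<Rightarrow> bool" where
  "fully_blocked G \<longleftrightarrow> (\<forall>e \<in> parcs G. blocked G e)"

definition FBD_graph :: "'a pair_pre_digraph \<Rightarrow> bool" where
  "FBD_graph G \<longleftrightarrow>
     oriented_graph G \<and> parcs G \<noteq> {} \<and> fully_blocked G \<and> \<not> (\<exists>a b c. three_cycle G a b c)"

end

theory Submission
  imports Defs
begin

text \<open>
  The proof is a double count of the pairs of an edge and a 3-clique in which it participates.
  A 3-clique has three edges, so the numbers \<open>\<alpha>(e)\<close> add up to at least three times the number
  of 3-cliques (\<open>three_mult_card_three_cliques_le\<close>). In a fully blocked graph every edge \<open>(a, b)\<close>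
  is the edge from the source to the sink of some simplex \<open>a \<rightarrow> c \<rightarrow> b\<close>. The vertex set of a
  simplex determines its source and its sink, so different edges get different 3-cliques, and
  there are at least as many 3-cliques as edges (\<open>card_parcs_le_card_three_cliques\<close>). Together,
  the average of \<open>\<alpha>\<close> over a fully blocked graph is at least 3. The maximum is at least
  the average, so it cannot be 2.
\<close>

lemma finite_three_cliques:
  assumes "finite (pverts G)"
  shows "finite (three_cliques G)"
proof (rule finite_subset)
  show "three_cliques G \<subseteq> Pow (pverts G)"
    by (auto simp: three_cliques_def three_cycle_def simplex_def)
qed (use assms in simp)

text \<open>
  Among the vertices of a simplex, the source is the only one with arcs to both others, and the
  sink the only one with arcs from both others; so the set of the three vertices determines them.
\<close>

lemma simplex_source_sink_unique:
  assumes "asym (parcs G)" and "simplex G a c b" and "simplex G a' c' b'"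
    and "{a, c, b} = {a', c', b'}"
  shows "a = a' \<and> b = b'"
proof -
  have asym: "(y, x) \<notin> parcs G" if "(x, y) \<in> parcs G" for x y
    using assms(1) that by (rule asymD)
  have arcs: "(a, c) \<in> parcs G" "(c, b) \<in> parcs G" "(a, b) \<in> parcs G"
    "(a', c') \<in> parcs G" "(c', b') \<in> parcs G" "(a', b') \<in> parcs G"
    using assms(2,3) by (auto simp: simplex_def)
  have "a' \<in> {a, c, b}" "b' \<in> {a, c, b}" "a \<in> {a', c', b'}" "b \<in> {a', c', b'}"
    using assms(4) by auto
  then show ?thesis using arcs asym by auto
qed

context oriented_graph
begin

lemma simplex_in_three_cliques:
  assumes "simplex G a c b"
  shows "{a, c, b} \<in> three_cliques G"
proof -
  have "a \<noteq> c" "c \<noteq> b" "a \<noteq> b"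
    using assms no_loops' by (auto simp: simplex_def)
  then have "card {a, c, b} = 3" by simp
  with assms show ?thesis by (auto simp: three_cliques_def)
qed

lemma three_le_card_participating_arcs:
  assumes "K \<in> three_cliques G"
  shows "3 \<le> card {e \<in> parcs G. participates e K}"
proof -
  obtain a b c where K: "K = {a, b, c}" and card: "card K = 3"
    and arcs: "(a, b) \<in> parcs G" "(b, c) \<in> parcs G" "(c, a) \<in> parcs G \<or> (a, c) \<in> parcs G"
    using assms by (auto simp: three_cliques_def three_cycle_def simplex_def)
  have ne: "a \<noteq> b" "b \<noteq> c" "a \<noteq> c"
    using card unfolding K by (auto simp: card_insert_if split: if_splits)
  define f where "f = (if (c, a) \<in> parcs G then (c, a) else (a, c))"
  have "card {(a, b), (b, c), f} = 3"
    using ne by (auto simp: f_def)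
  moreover have "{(a, b), (b, c), f} \<subseteq> {e \<in> parcs G. participates e K}"
    using arcs by (auto simp: f_def K participates_def)
  ultimately show ?thesis
    using card_mono[of "{e \<in> parcs G. participates e K}" "{(a, b), (b, c), f}"] by simp
qed

text \<open>
  The right-hand side is the number of pairs of an edge and a 3-clique in which it participates.
  Counted by 3-cliques instead, each of them contributes at least 3 pairs.
\<close>

lemma three_mult_card_three_cliques_le:
  "3 * card (three_cliques G) \<le> (\<Sum>e\<in>parcs G. clique_count G e)"
proof -
  have "3 * card (three_cliques G) = (\<Sum>K\<in>three_cliques G. 3)"
    by simp
  also have "\<dots> \<le> (\<Sum>K\<in>three_cliques G. card {e \<in> parcs G. participates e K})"
    by (intro sum_mono three_le_card_participating_arcs)
  also have "\<dots> = (\<Sum>e\<in>parcs G. clique_count G e)"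
    unfolding clique_count_def
    using sum_multicount_gen[of "three_cliques G" "parcs G" "\<lambda>K e. participates e K"
        "\<lambda>e. card {K \<in> three_cliques G. participates e K}"]
    by (simp add: finite_three_cliques)
  finally show ?thesis .
qed

text \<open>
  An edge is sent to the simplex formed with a vertex that blocks it; the edge is recovered as the
  pair of the source and the sink.
\<close>

lemma card_parcs_le_card_three_cliques:
  assumes "fully_blocked G"
  shows "card (parcs G) \<le> card (three_cliques G)"
proof -
  have "\<exists>c. simplex G (fst e) c (snd e)" if "e \<in> parcs G" for e
    using assms that in_arcsD1 in_arcsD2
    by (cases e) (fastforce simp: fully_blocked_def blocked_def simplex_def)
  then obtain c where c: "simplex G (fst e) (c e) (snd e)" if "e \<in> parcs G" for e
    by metis
  have "inj_on (\<lambda>e. {fst e, c e, snd e}) (parcs G)"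
    by (intro inj_onI prod_eqI)
      (use simplex_source_sink_unique[OF asym_arcs c c] in blast)+
  then show ?thesis
    by (rule card_inj_on_le)
      (use c simplex_in_three_cliques finite_three_cliques[OF pair_finite_verts] in auto)
qed

lemma three_mult_card_parcs_le:
  assumes "fully_blocked G"
  shows "3 * card (parcs G) \<le> (\<Sum>e\<in>parcs G. clique_count G e)"
  using card_parcs_le_card_three_cliques[OF assms] three_mult_card_three_cliques_le by linarith

end

theorem lemma2:
  fixes G :: "'a pair_pre_digraph"
  assumes "oriented_graph G" and "parcs G \<noteq> {}"
  shows "((1 / real (card (parcs G))) * (\<Sum>e\<in>parcs G. real (clique_count G e)) < 3
            \<longrightarrow> \<not> FBD_graph G)
       \<and> (Max (clique_count G ` parcs G) = 2 \<longrightarrow> \<not> FBD_graph G)"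
proof -
  interpret oriented_graph G by fact
  have pos: "0 < card (parcs G)"
    using assms(2) by (simp add: card_gt_0_iff)
  have sum_ge: "3 * card (parcs G) \<le> (\<Sum>e\<in>parcs G. clique_count G e)" if "FBD_graph G"
    using that three_mult_card_parcs_le by (simp add: FBD_graph_def)
  have "\<not> FBD_graph G"
    if "(1 / real (card (parcs G))) * (\<Sum>e\<in>parcs G. real (clique_count G e)) < 3"
  proof
    assume "FBD_graph G"
    then have "real (3 * card (parcs G)) \<le> real (\<Sum>e\<in>parcs G. clique_count G e)"
      using sum_ge by (simp only: of_nat_le_iff)
    with that pos show False by (simp add: field_simps)
  qed
  moreover have "\<not> FBD_graph G" if "Max (clique_count G ` parcs G) = 2"
  proof
    assume "FBD_graph G"
    have "clique_count G e \<le> 2" if "e \<in> parcs G" for e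
      using that Max_ge[of "clique_count G ` parcs G" "clique_count G e"]
        \<open>Max (clique_count G ` parcs G) = 2\<close> by simp
    then have "(\<Sum>e\<in>parcs G. clique_count G e) \<le> card (parcs G) * 2"
      using sum_bounded_above[of "parcs G" "clique_count G" 2] by simp
    with sum_ge[OF \<open>FBD_graph G\<close>] pos show False by linarith
  qed
  ultimately show ?thesis by blast
qed

end
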